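(* Let $\varepsilon>0$. No deterministic algorithm for the fractional knapsack problem in the random-order model is $(\frac1e+\varepsilon)$-competitive.
   Context: Fractional knapsack problem: a knapsack of capacity $C>0$ and items $[n]$, each item $j$ having value $v_j>0$ and size $s_j>0$. A feasible solution is $\mathbf{x}\in[0,1]^n$ with $\sum_j s_jx_j\le C$, with value $v(\mathbf{x})=\sum_j v_jx_j$; let $\tilde{\mathbf{x}}$ denote an optimal feasible solution. Random-order model: the algorithm knows $n$ and $C$, items arrive in rounds $1,\dots,n$ in the order $\pi(1),\dots,\pi(n)$ for a uniformly random permutation $\pi$ of $[n]$; the value and size of an item are revealed upon its arrival, and the algorithm must immediately and irrevocably choose the fraction $x_{\pi(\ell)}\in[0,1]$ of the current item to pack, keeping the solution feasible. An algorithm is $\alpha$-competitive if on every instance its output satisfies $\mathbb{E}[v(\mathbf{x})]\ge(\alpha-o(1))\,v(\tilde{\mathbf{x}})$, with the expectation over $\pi$ and $o(1)$ with respect to $n\to\infty$. A deterministic algorithm is one whose decision in each round is a deterministic function of the items observed so far. *)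

theory Defs
  imports
    "HOL-Probability.Probability"
    "HOL-Combinatorics.Permutations"
    "HOL-Library.Landau_Symbols"
begin

text \<open>
  The items are \<open>1, \<dots>, n\<close>; item \<open>j\<close> has value \<open>v j\<close> and size \<open>s j\<close>. The functions
  \<open>v\<close>, \<open>s\<close> and solutions \<open>x\<close> are only meaningful on \<open>{1..n}\<close>.
\<close>

definition knapsack_inst :: "nat \<Rightarrow> real \<Rightarrow> (nat \<Rightarrow> real) \<Rightarrow> (nat \<Rightarrow> real) \<Rightarrow> bool" where
  "knapsack_inst n C v s \<longleftrightarrow> C > 0 \<and> (\<forall>j\<in>{1..n}. v j > 0 \<and> s j > 0)"

definition feasible :: "nat \<Rightarrow> real \<Rightarrow> (nat \<Rightarrow> real) \<Rightarrow> (nat \<Rightarrow> real) \<Rightarrow> bool" where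
  "feasible n C s x \<longleftrightarrow> (\<forall>j\<in>{1..n}. 0 \<le> x j \<and> x j \<le> 1) \<and> (\<Sum>j=1..n. s j * x j) \<le> C"

definition solution_value :: "nat \<Rightarrow> (nat \<Rightarrow> real) \<Rightarrow> (nat \<Rightarrow> real) \<Rightarrow> real" where
  "solution_value n v x = (\<Sum>j=1..n. v j * x j)"

definition optimal ::
  "nat \<Rightarrow> real \<Rightarrow> (nat \<Rightarrow> real) \<Rightarrow> (nat \<Rightarrow> real) \<Rightarrow> (nat \<Rightarrow> real) \<Rightarrow> bool" where
  "optimal n C v s x \<longleftrightarrow> feasible n C s x \<and>
     (\<forall>y. feasible n C s y \<longrightarrow> solution_value n v y \<le> solution_value n v x)"

text \<open>
  A deterministic decision rule maps \<open>n\<close>, \<open>C\<close> and the (value, size) pairs revealed so far, in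
  order of arrival and with the current item last, to the fraction of the current item to be
  packed. Earlier decisions are determined by this history, so they need not be passed on.
\<close>

type_synonym decision_rule = "nat \<Rightarrow> real \<Rightarrow> (real \<times> real) list \<Rightarrow> real"

definition observed ::
  "(nat \<Rightarrow> real) \<Rightarrow> (nat \<Rightarrow> real) \<Rightarrow> (nat \<Rightarrow> nat) \<Rightarrow> nat \<Rightarrow> (real \<times> real) list" where
  "observed v s \<pi> l = map (\<lambda>i. (v (\<pi> i), s (\<pi> i))) [1..<Suc l]"

text \<open>Item \<open>j\<close> arrives in round \<open>inv \<pi> j\<close>.\<close>

definition packing ::
  "decision_rule \<Rightarrow> nat \<Rightarrow> real \<Rightarrow> (nat \<Rightarrow> real) \<Rightarrow> (nat \<Rightarrow> real) \<Rightarrow> (nat \<Rightarrow> nat) \<Rightarrow> nat \<Rightarrow> real" where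
  "packing A n C v s \<pi> j = A n C (observed v s \<pi> (inv \<pi> j))"

text \<open>
  Since sizes are positive and fractions nonnegative, the packed size never decreases, so
  feasibility of the final output is the same as feasibility after every round.
\<close>

definition deterministic_algorithm :: "decision_rule \<Rightarrow> bool" where
  "deterministic_algorithm A \<longleftrightarrow>
     (\<forall>n C v s \<pi>. knapsack_inst n C v s \<longrightarrow> \<pi> permutes {1..n} \<longrightarrow>
        feasible n C s (packing A n C v s \<pi>))"

definition expected_value ::
  "decision_rule \<Rightarrow> nat \<Rightarrow> real \<Rightarrow> (nat \<Rightarrow> real) \<Rightarrow> (nat \<Rightarrow> real) \<Rightarrow> real" where
  "expected_value A n C v s =
     measure_pmf.expectation (pmf_of_set {\<pi>. \<pi> permutes {1..n}})
       (\<lambda>\<pi>. solution_value n v (packing A n C v s \<pi>))"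

text \<open>The error term depends on \<open>n\<close> only; it is uniform over all instances with \<open>n\<close> items.\<close>

definition competitive :: "real \<Rightarrow> decision_rule \<Rightarrow> bool" where
  "competitive \<alpha> A \<longleftrightarrow>
     (\<exists>\<delta>::nat \<Rightarrow> real. \<delta> \<in> o(\<lambda>_. 1) \<and>
        (\<forall>n C v s xopt. knapsack_inst n C v s \<longrightarrow> optimal n C v s xopt \<longrightarrow>
           expected_value A n C v s \<ge> (\<alpha> - \<delta> n) * solution_value n v xopt))"

end

(*
  All items get size 1 in a knapsack of capacity 1, so a solution is a fractional choice of one item
  and the optimum is the largest value. Values are powers of a large M, hence only the fraction
  given to the most valuable item matters. Rounding the decisions to multiples of 1/K leaves
  finitely many patterns, and Ramsey's theorem yields infinitely many exponents on which the rounded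
  decisions depend on the relative order of the observed values only. For such ordinal rules, the
  probability mass z_k put on a record in round k satisfies the linear program of the secretary
  problem, and an explicit dual solution bounds its value by 1/e + 2/n.
*)
theory Submission
  imports Defs "HOL-Library.Ramsey" "HOL-Combinatorics.Multiset_Permutations"
begin

section \<open>Orderings built by inserting relative ranks\<close>

text \<open>Orderings record ranks in order of arrival; \<open>bump r\<close> re-ranks the earlier
  items once an item of relative rank \<open>r\<close> arrives.\<close>

definition bump :: "nat \<Rightarrow> nat \<Rightarrow> nat" where
  "bump r x = (if x < r then x else Suc x)"

definition append_rank :: "nat list \<Rightarrow> nat \<Rightarrow> nat list" where
  "append_rank xs r = map (bump r) xs @ [r]"

abbreviation orderings :: "nat \<Rightarrow> nat list set" where
  "orderings n \<equiv> permutations_of_set {..<n}"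

lemma length_orderings: "xs \<in> orderings n \<Longrightarrow> length xs = n"
  using distinct_card[of xs] by (simp add: permutations_of_set_def)

lemma strict_mono_bump: "strict_mono (bump r)"
  by (auto simp: strict_mono_def bump_def)

lemma bump_neq: "bump r x \<noteq> r"
  by (auto simp: bump_def)

lemma append_rank_in_orderings:
  assumes "xs \<in> orderings n" "r \<le> n"
  shows "append_rank xs r \<in> orderings (Suc n)"
proof -
  have xs: "set xs = {..<n}" "distinct xs"
    using assms(1) by (auto simp: permutations_of_set_def)
  have "inj_on (bump r) (set xs)"
    using strict_mono_bump strict_mono_imp_inj_on inj_on_subset by blast
  moreover have "r \<notin> bump r ` set xs"
    using bump_neq[of r] by (metis imageE)
  ultimately have "distinct (append_rank xs r)"
    using xs by (simp add: append_rank_def distinct_map)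
  moreover have "y \<in> set (append_rank xs r)" if "y \<le> n" for y
  proof -
    consider "y < r" | "y = r" | "y > r" by linarith
    then show ?thesis
    proof cases
      case 1
      then show ?thesis using assms(2) xs by (auto simp: append_rank_def bump_def image_iff)
    next
      case 3
      then have "y = bump r (y - 1)" "y - 1 < n" using that by (auto simp: bump_def)
      then show ?thesis using xs by (auto simp: append_rank_def)
    qed (simp add: append_rank_def)
  qed
  moreover have "set (append_rank xs r) \<subseteq> {..<Suc n}"
    using assms(2) by (auto simp: append_rank_def bump_def xs(1))
  ultimately show ?thesis
    by (auto simp: permutations_of_set_def)
qed

text \<open>The last entry of the new list reveals \<open>r\<close>, and \<open>bump r\<close> is
  injective; surjectivity follows by counting, as n! (n + 1) = (n + 1)!. In probabilistic terms, the
  rank of a new arrival is uniform and independent of the earlier order.\<close>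

lemma bij_betw_append_rank:
  "bij_betw (\<lambda>(xs, r). append_rank xs r) (orderings n \<times> {..n}) (orderings (Suc n))"
proof -
  have "inj_on (\<lambda>(xs, r). append_rank xs r) (orderings n \<times> {..n})"
  proof (rule inj_onI, clarify)
    fix xs ys r q assume "append_rank xs r = append_rank ys q"
    moreover have "inj (bump r)"
      by (intro strict_mono_imp_inj_on strict_mono_bump)
    ultimately show "xs = ys \<and> r = q"
      by (auto simp: append_rank_def inj_map_eq_map)
  qed
  moreover have "(\<lambda>(xs, r). append_rank xs r) ` (orderings n \<times> {..n}) \<subseteq> orderings (Suc n)"
    using append_rank_in_orderings by auto
  moreover have "card (orderings n \<times> {..n}) = card (orderings (Suc n))"
    by (simp add: card_cartesian_product)
  ultimately show ?thesis
    by (metis bij_betw_imageI card_image card_subset_eq finite_lessThan finite_permutations_of_set)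
qed

lemma sum_orderings_Suc:
  "(\<Sum>xs\<in>orderings (Suc n). f xs) = (\<Sum>xs\<in>orderings n. \<Sum>r\<le>n. f (append_rank xs r))"
  by (simp add: sum.cartesian_product sum.reindex_bij_betw[OF bij_betw_append_rank, symmetric] split_def)

lemma append_rank_top:
  assumes "xs \<in> orderings n"
  shows "append_rank xs n = xs @ [n]"
proof -
  have "\<forall>x\<in>set xs. bump n x = x"
    using assms by (auto simp: permutations_of_set_def bump_def)
  then show ?thesis by (simp add: append_rank_def map_idI)
qed

section \<open>Order-invariant rules and the secretary linear program\<close>

text \<open>The abstract comparison-based algorithm: \<open>h\<close> is the fraction given to the
  last item of the observed list. Invariance stops at length \<open>N\<close> because Ramsey's
  theorem is applied to finitely many patterns; \<open>capacity\<close> passes from full orderings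
  to prefixes in \<open>capacity_prefix\<close>.\<close>

locale ordinal_rule =
  fixes N :: nat and h :: "nat list \<Rightarrow> real"
  assumes nonneg: "0 \<le> h xs"
    and invariant: "\<lbrakk>strict_mono f; distinct xs; length xs \<le> N\<rbrakk> \<Longrightarrow> h (map f xs) = h xs"
    and capacity: "xs \<in> orderings N \<Longrightarrow> (\<Sum>k<N. h (take (Suc k) xs)) \<le> 1"
begin

text \<open>On a prefix, \<open>append_rank\<close> acts by the strictly monotone
  \<open>bump r\<close>, so order invariance makes past decisions independent of how later items
  rank.\<close>

lemma h_append_rank:
  assumes "xs \<in> orderings n" "i < n" "n \<le> N"
  shows "h (take (Suc i) (append_rank xs r)) = h (take (Suc i) xs)"
proof -
  have "length xs = n" "distinct xs"
    using assms(1) length_orderings by (auto simp: permutations_of_set_def)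
  then have "take (Suc i) (append_rank xs r) = map (bump r) (take (Suc i) xs)"
    using assms(2) by (simp add: append_rank_def take_map)
  moreover have "h (map (bump r) (take (Suc i) xs)) = h (take (Suc i) xs)"
    using assms \<open>distinct xs\<close> \<open>length xs = n\<close> by (intro invariant strict_mono_bump) auto
  ultimately show ?thesis by simp
qed

text \<open>
  Rounds are numbered from 0. The sums are not normalised: divided by the number of orderings, they
  are expectations over a uniformly random order.
\<close>

definition best :: "nat \<Rightarrow> nat \<Rightarrow> real" where
  "best k m = (\<Sum>xs\<in>orderings (Suc m). h (take (Suc k) xs) * of_bool (xs ! k = m))"

definition total :: "nat \<Rightarrow> nat \<Rightarrow> real" where
  "total k n = (\<Sum>xs\<in>orderings n. h (take (Suc k) xs))"

text \<open>The variable z_k of the linear program: the expected fraction packed in round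
  \<open>k\<close>, restricted to the event that its item beats all earlier ones.\<close>

definition record_mass :: "nat \<Rightarrow> real" where
  "record_mass k = best k k / fact (Suc k)"

text \<open>Of the m + 2 ranks open to the next arrival, all but the top one leave the item of round
  \<open>k\<close> in the lead.\<close>

lemma best_Suc:
  assumes "k \<le> m" "Suc m \<le> N"
  shows "best k (Suc m) = real (Suc m) * best k m"
proof -
  have "(\<Sum>r\<le>Suc m. h (take (Suc k) (append_rank xs r)) * of_bool (append_rank xs r ! k = Suc m))
      = real (Suc m) * (h (take (Suc k) xs) * of_bool (xs ! k = m))"
    if xs: "xs \<in> orderings (Suc m)" for xs
  proof -
    have len: "length xs = Suc m" using length_orderings[OF xs] .
    have "xs ! k < Suc m"
      using xs len assms(1) nth_mem[of k xs] by (auto simp: permutations_of_set_def)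
    moreover have "append_rank xs r ! k = bump r (xs ! k)" for r
      using len assms(1) by (simp add: append_rank_def nth_append)
    ultimately have "append_rank xs r ! k = Suc m \<longleftrightarrow> xs ! k = m \<and> r \<le> m" for r
      by (auto simp: bump_def)
    then have "(\<Sum>r\<le>Suc m. h (take (Suc k) (append_rank xs r)) * of_bool (append_rank xs r ! k = Suc m))
      = (\<Sum>r\<le>Suc m. h (take (Suc k) xs) * of_bool (xs ! k = m) * of_bool (r \<le> m))"
      using h_append_rank[OF xs, of k] assms by (intro sum.cong) (auto simp: less_Suc_eq_le)
    also have "\<dots> = real (Suc m) * (h (take (Suc k) xs) * of_bool (xs ! k = m))"
      by simp
    finally show ?thesis .
  qed
  then show ?thesis
    unfolding best_def sum_orderings_Suc[of _ "Suc m"] sum_distrib_left by (intro sum.cong) auto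
qed

text \<open>Divided by (m + 1)!, this says that a record of round \<open>k\<close> is the best of
  all m + 1 items with probability (k + 1)/(m + 1), whatever fraction it received.\<close>

lemma best_eq:
  assumes "k \<le> m" "m < N"
  shows "best k m = fact m / fact k * best k k"
  using assms
proof (induction m rule: dec_induct)
  case (step m)
  then show ?case using best_Suc[of k m] by simp
qed simp

lemma total_Suc:
  assumes "k < n" "n \<le> N"
  shows "total k (Suc n) = real (Suc n) * total k n"
  unfolding total_def sum_orderings_Suc sum_distrib_left
  by (intro sum.cong refl) (simp add: h_append_rank[OF _ assms])

lemma record_mass_nonneg: "0 \<le> record_mass k"
  by (simp add: record_mass_def best_def nonneg sum_nonneg)

text \<open>Lets the linear program ignore what is packed on items that are not records.\<close>

lemma record_mass_le_total:
  assumes "k < n" "n \<le> N"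
  shows "fact n * record_mass k \<le> total k n"
  using Suc_leI[OF assms(1)] assms(2)
proof (induction n rule: dec_induct)
  case base
  have "best k k \<le> total k (Suc k)"
    unfolding best_def total_def by (intro sum_mono) (simp add: nonneg)
  then show ?case by (simp add: record_mass_def)
next
  case (step n)
  then have "real (Suc n) * (fact n * record_mass k) \<le> real (Suc n) * total k n"
    by (intro mult_left_mono) auto
  then show ?case using step total_Suc[of k n] by (simp add: mult.assoc)
qed

text \<open>Appending the missing ranks in increasing order completes the prefix to an ordering to
  which \<open>capacity\<close> applies; the extra terms are nonnegative.\<close>

lemma capacity_prefix:
  assumes "xs \<in> orderings n" "n \<le> N"
  shows "(\<Sum>k<n. h (take (Suc k) xs)) \<le> 1"
proof -
  have len: "length xs = n" using assms(1) length_orderings by blast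
  have xs: "set xs = {..<n}" "distinct xs"
    using permutations_of_setD[OF assms(1)] .
  have "set (xs @ [n..<N]) = {..<N}" "distinct (xs @ [n..<N])"
    using assms(2) by (auto simp: xs)
  then have "xs @ [n..<N] \<in> orderings N" by (rule permutations_of_setI)
  then have "(\<Sum>k<N. h (take (Suc k) (xs @ [n..<N]))) \<le> 1" by (rule capacity)
  moreover have "(\<Sum>k<n. h (take (Suc k) xs)) = (\<Sum>k<n. h (take (Suc k) (xs @ [n..<N])))"
    using len by (intro sum.cong) auto
  moreover have "\<dots> \<le> (\<Sum>k<N. h (take (Suc k) (xs @ [n..<N])))"
    using assms(2) by (intro sum_mono2) (auto simp: nonneg)
  ultimately show ?thesis by linarith
qed

text \<open>
  Whether round \<open>k\<close> brings a record is independent of the order of the earlier items, hence of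
  the capacity used before.
\<close>

lemma record_mass_constraint:
  assumes "k < N"
  shows "real (Suc k) * record_mass k + (\<Sum>i<k. record_mass i) \<le> 1"
proof -
  have "best k k = (\<Sum>ys\<in>orderings k. \<Sum>r\<le>k.
      h (take (Suc k) (append_rank ys r)) * of_bool (append_rank ys r ! k = k))"
    unfolding best_def sum_orderings_Suc ..
  also have "\<dots> = (\<Sum>ys\<in>orderings k. h (ys @ [k]))"
  proof (intro sum.cong refl)
    fix ys assume ys: "ys \<in> orderings k"
    then have "length ys = k" by (rule length_orderings)
    then have "append_rank ys r ! k = r" "take (Suc k) (append_rank ys r) = append_rank ys r" for r
      by (simp_all add: append_rank_def nth_append)
    then have "(\<Sum>r\<le>k. h (take (Suc k) (append_rank ys r)) * of_bool (append_rank ys r ! k = k))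
      = (\<Sum>r\<le>k. if r = k then h (append_rank ys k) else 0)"
      by (intro sum.cong) auto
    then show "(\<Sum>r\<le>k. h (take (Suc k) (append_rank ys r)) * of_bool (append_rank ys r ! k = k))
      = h (ys @ [k])"
      by (simp add: append_rank_top[OF ys])
  qed
  \<comment> \<open>Only the rank \<open>r = k\<close> makes a record. It leaves the earlier entries
    \<open>ys\<close> unchanged, so the record gets at most the capacity that the decisions along
    \<open>ys\<close> left over.\<close>
  also have "\<dots> \<le> (\<Sum>ys\<in>orderings k. 1 - (\<Sum>i<k. h (take (Suc i) ys)))"
  proof (intro sum_mono)
    fix ys assume ys: "ys \<in> orderings k"
    then have len: "length ys = k" by (rule length_orderings)
    have "ys @ [k] \<in> orderings (Suc k)"
      using append_rank_in_orderings[OF ys, of k] by (simp add: append_rank_top[OF ys])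
    then have "(\<Sum>i<Suc k. h (take (Suc i) (ys @ [k]))) \<le> 1"
      using assms by (intro capacity_prefix) auto
    moreover have "(\<Sum>i<k. h (take (Suc i) (ys @ [k]))) = (\<Sum>i<k. h (take (Suc i) ys))"
      using len by (intro sum.cong) auto
    ultimately show "h (ys @ [k]) \<le> 1 - (\<Sum>i<k. h (take (Suc i) ys))"
      using len by (simp del: take_append)
  qed
  also have "\<dots> = fact k - (\<Sum>i<k. total i k)"
    unfolding total_def by (subst sum.swap) (simp add: sum_subtractf)
  also have "\<dots> \<le> fact k - (\<Sum>i<k. fact k * record_mass i)"
    using assms by (intro diff_left_mono sum_mono record_mass_le_total) auto
  also have "\<dots> = fact k * (1 - (\<Sum>i<k. record_mass i))"
    by (simp add: sum_distrib_left right_diff_distrib)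
  finally have "best k k / fact k \<le> 1 - (\<Sum>i<k. record_mass i)"
    by (simp add: field_simps)
  \<comment> \<open>Round \<open>k\<close> brings a record with probability 1/(k + 1), so this is
    the expected fraction given a record.\<close>
  moreover have "real (Suc k) * record_mass k = best k k / fact k"
    by (simp add: record_mass_def del: of_nat_Suc)
  ultimately show ?thesis by linarith
qed

end

section \<open>A dual solution of the secretary linear program\<close>

text \<open>The dual variables are the differences \<open>R k - R (Suc k)\<close>.\<close>

lemma secretary_lp_weak_duality:
  fixes z R :: "nat \<Rightarrow> real"
  assumes z: "\<And>k. k < N \<Longrightarrow> 0 \<le> z k"
    and primal: "\<And>k. k < N \<Longrightarrow> real (Suc k) * z k + (\<Sum>i<k. z i) \<le> 1"
    and R: "\<And>k. k < N \<Longrightarrow> R (Suc k) \<le> R k"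
    and dual: "\<And>k. k < N \<Longrightarrow> c k \<le> real (Suc k) * (R k - R (Suc k)) + R (Suc k)"
    and RN: "R N = 0"
  shows "(\<Sum>k<N. c k * z k) \<le> R 0"
proof -
  \<comment> \<open>Summation by parts: the dual variables of the rounds after \<open>k\<close>
    telescope to \<open>R (Suc k)\<close>, up to a boundary term that vanishes at
    \<open>n = N\<close>.\<close>
  have parts: "(\<Sum>k<n. z k * (real (Suc k) * (R k - R (Suc k)) + R (Suc k)))
    = (\<Sum>k<n. (R k - R (Suc k)) * (real (Suc k) * z k + (\<Sum>i<k. z i))) + R n * (\<Sum>i<n. z i)" for n
    by (induction n) (simp_all add: algebra_simps)
  have "(\<Sum>k<N. c k * z k) \<le> (\<Sum>k<N. z k * (real (Suc k) * (R k - R (Suc k)) + R (Suc k)))"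
    using dual z by (intro sum_mono) (subst mult.commute, auto intro: mult_left_mono)
  also have "\<dots> = (\<Sum>k<N. (R k - R (Suc k)) * (real (Suc k) * z k + (\<Sum>i<k. z i)))"
    using parts[of N] RN by simp
  also have "\<dots> \<le> (\<Sum>k<N. (R k - R (Suc k)) * 1)"
    using R primal by (intro sum_mono mult_left_mono) auto
  also have "\<dots> = R 0"
    using RN by (simp add: sum_lessThan_telescope')
  finally show ?thesis .
qed

text \<open>Termwise, 1/j is at most ln j - ln (j - 1), by ln x <= x - 1 at x = (j - 1)/j.\<close>

lemma sum_inverse_le_ln:
  assumes "2 \<le> a" "a \<le> b"
  shows "(\<Sum>j=a..<b. 1 / real j) \<le> ln (real (b - 1)) - ln (real (a - 1))"
  using assms(2,1)
proof (induction b rule: dec_induct)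
  case (step b)
  have b: "real b > 1" using step by simp
  have "ln (real (b - 1) / real b) \<le> real (b - 1) / real b - 1"
    using b step by (intro ln_le_minus_one) auto
  also have "\<dots> = - (1 / real b)"
    using b by (simp add: field_simps of_nat_diff)
  finally have "1 / real b \<le> ln (real b) - ln (real (b - 1))"
    using b step by (simp add: ln_div)
  then show ?case using step by simp
qed simp

text \<open>Weak duality with the value function of optimal stopping as \<open>R\<close>. Its
  initial value is at most (1 + \<open>\<tau>\<close>)/N, and \<open>\<tau>\<close> exceeds N/e by
  at most 1.\<close>

lemma secretary_lp_bound:
  fixes z :: "nat \<Rightarrow> real"
  assumes N: "2 \<le> N"
    and z: "\<And>k. k < N \<Longrightarrow> 0 \<le> z k"
    and primal: "\<And>k. k < N \<Longrightarrow> real (Suc k) * z k + (\<Sum>i<k. z i) \<le> 1"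
  shows "(\<Sum>k<N. real (Suc k) / real N * z k) \<le> 1 / exp 1 + 2 / real N"
proof -
  define H where "H k = (\<Sum>j=k..<N. 1 / real j)" for k
  have H_Suc: "H k = 1 / real k + H (Suc k)" if "k < N" for k
    unfolding H_def using that by (simp add: sum.atLeast_Suc_lessThan)
  have H_N: "H N = 0" by (simp add: H_def)
  \<comment> \<open>the number of items that the classical secretary rule only observes\<close>
  define \<tau> where "\<tau> = (GREATEST k. 1 \<le> H k)"
  \<comment> \<open>Beyond \<open>N\<close> the sum \<open>H\<close> is empty, hence 0; so the
    greatest \<open>k\<close> exists.\<close>
  have bound: "k \<le> N" if "1 \<le> H k" for k
    using that by (cases "k \<le> N") (simp_all add: H_def)
  have "H (Suc 1) \<ge> 0" by (simp add: H_def sum_nonneg)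
  then have "1 \<le> H 1" using H_Suc[of 1] N by simp
  then have tau: "1 \<le> H \<tau>" "1 \<le> \<tau>"
    unfolding \<tau>_def using GreatestI_nat[where P = "\<lambda>k. 1 \<le> H k", OF _ bound]
      Greatest_le_nat[where P = "\<lambda>k. 1 \<le> H k", OF _ bound] by blast+
  have H_less: "H k < 1" if "\<tau> < k" for k
    using Greatest_le_nat[of "\<lambda>k. 1 \<le> H k" k N] bound that unfolding \<tau>_def by force
  have tauN: "\<tau> < N"
    using tau(1) H_N bound[of \<tau>] by (cases "\<tau> = N") auto
  \<comment> \<open>For \<open>k\<close> from \<open>\<tau>\<close> to \<open>N\<close>, the success
    probability of the rule that rejects the first \<open>k\<close> items and takes the next record;
    before \<open>\<tau>\<close>, waiting until \<open>\<tau>\<close> is better, so \<open>R\<close>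
    is constant.\<close>
  define R where "R k = real (max k \<tau>) / real N * H (max k \<tau>)" for k
  have R_step: "R k - R (Suc k) = (1 - H (Suc k)) / real N" if "\<tau> \<le> k" "k < N" for k
    using that tau H_Suc[of k] by (simp add: R_def max_def field_simps)
  have R_const: "R k = R \<tau>" if "k \<le> \<tau>" for k
    using that by (simp add: R_def)
  have "(\<Sum>k<N. real (Suc k) / real N * z k) \<le> R 0"
  proof (rule secretary_lp_weak_duality[of N z R "\<lambda>k. real (Suc k) / real N", OF z primal])
    fix k assume k: "k < N"
    show "R (Suc k) \<le> R k"
    proof (cases "\<tau> \<le> k")
      case True
      have "0 \<le> R k - R (Suc k)"
        unfolding R_step[OF True k] using True H_less[of "Suc k"]
        by (intro divide_nonneg_nonneg) auto
      then show ?thesis by simp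
    qed (use R_const[of k] R_const[of "Suc k"] in simp)
    \<comment> \<open>From \<open>\<tau>\<close> on the constraint is tight. Before it,
      \<open>R\<close> is constant, and \<open>1 \<le> H \<tau>\<close> gives
      R(\<open>\<tau>\<close>) >= \<open>\<tau>\<close>/N >= (k + 1)/N.\<close>
    show "real (Suc k) / real N \<le> real (Suc k) * (R k - R (Suc k)) + R (Suc k)"
    proof (cases "\<tau> \<le> k")
      case True
      then have "R (Suc k) = real (Suc k) * (H (Suc k) / real N)"
        by (simp add: R_def max_def del: of_nat_Suc)
      then show ?thesis unfolding R_step[OF True k]
        by (simp add: diff_divide_distrib right_diff_distrib del: of_nat_Suc)
    next
      case False
      then have "real (Suc k) \<le> real \<tau> * 1" by simp
      also have "\<dots> \<le> real \<tau> * H \<tau>" using tau by (intro mult_left_mono) auto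
      finally have "real (Suc k) / real N \<le> R \<tau>"
        unfolding R_def by (simp add: divide_right_mono)
      then show ?thesis using False R_const[of k] R_const[of "Suc k"] by simp
    qed
  qed (use tauN H_N in \<open>auto simp: R_def max_def\<close>)
  also have "R 0 = (1 + real \<tau> * H (Suc \<tau>)) / real N"
    using tau tauN H_Suc[of \<tau>] by (simp add: R_def field_simps)
  also have "\<dots> \<le> (1 + real \<tau> * 1) / real N"
    using H_less[of "Suc \<tau>"] by (intro divide_right_mono add_left_mono mult_left_mono) auto
  also have "\<dots> \<le> (real N / exp 1 + 2) / real N"
  proof (intro divide_right_mono)
    \<comment> \<open>From 1 <= H(\<open>\<tau>\<close>) <= ln ((N - 1)/(\<open>\<tau>\<close> -
      1)); the case \<open>\<tau> = 1\<close> is separate because the logarithm needs a positive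
      denominator.\<close>
    have "real \<tau> - 1 \<le> real N / exp 1"
    proof (cases "\<tau> = 1")
      case False
      then have "2 \<le> \<tau>" using tau by simp
      then have "1 \<le> ln (real (N - 1)) - ln (real (\<tau> - 1))"
        using sum_inverse_le_ln[of \<tau> N] tauN tau unfolding H_def by simp
      then have "exp 1 * real (\<tau> - 1) \<le> exp (ln (real (N - 1)))"
        using \<open>2 \<le> \<tau>\<close> exp_le_cancel_iff[of "1 + ln (real (\<tau> - 1))" "ln (real (N - 1))"]
        by (simp add: exp_add)
      also have "\<dots> \<le> real N" using N by simp
      finally show ?thesis using \<open>2 \<le> \<tau>\<close> by (simp add: field_simps of_nat_diff)
    qed simp
    then show "1 + real \<tau> * 1 \<le> real N / exp 1 + 2" by simp
  qed simp
  also have "\<dots> = 1 / exp 1 + 2 / real N"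
    using N by (simp add: add_divide_distrib)
  finally show ?thesis .
qed

text \<open>Splitting by the round in which the top rank \<open>N - 1\<close> arrives turns the
  expectation, through \<open>best_eq\<close>, into the objective of the linear program.\<close>

lemma (in ordinal_rule) expected_best_le:
  assumes "2 \<le> N"
  shows "(\<Sum>xs\<in>orderings N. \<Sum>k<N. h (take (Suc k) xs) * of_bool (xs ! k = N - 1)) / fact N
    \<le> 1 / exp 1 + 2 / real N"
proof -
  obtain m where m: "N = Suc m" using assms by (cases N) auto
  have "(\<Sum>xs\<in>orderings N. \<Sum>k<N. h (take (Suc k) xs) * of_bool (xs ! k = N - 1)) / fact N
    = (\<Sum>k<N. best k m / fact N)"
    unfolding best_def sum_divide_distrib[symmetric] by (subst sum.swap) (simp only: m diff_Suc_1)
  also have "\<dots> = (\<Sum>k<N. real (Suc k) / real N * record_mass k)"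
  proof (intro sum.cong refl)
    fix k assume "k \<in> {..<N}"
    then have "best k m = fact m / fact k * best k k" using m by (intro best_eq) auto
    then show "best k m / fact N = real (Suc k) / real N * record_mass k"
      unfolding m record_mass_def by (simp add: field_simps del: of_nat_Suc)
  qed
  also have "\<dots> \<le> 1 / exp 1 + 2 / real N"
    using assms record_mass_nonneg record_mass_constraint by (intro secretary_lp_bound)
  finally show ?thesis .
qed

section \<open>Making a rule order-invariant by Ramsey's theorem\<close>

text \<open>
  A pattern \<open>xs\<close> lists positions in the increasing enumeration of \<open>X\<close>.
\<close>

lemma Ramsey_patterns:
  fixes D :: "nat list \<Rightarrow> nat"
  assumes "finite Q" and D: "\<And>ys. D ys < s"
  shows "\<exists>Y. infinite Y \<and> (\<forall>xs\<in>Q. \<exists>t. \<forall>X. X \<subseteq> Y \<and> finite X \<and> card X = length xs \<longrightarrow>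
    D (map ((!) (sorted_list_of_set X)) xs) = t)"
  using assms(1)
proof (induction Q rule: finite_induct)
  case (insert q Q)
  then obtain Y where Y: "infinite Y" "\<forall>xs\<in>Q. \<exists>t. \<forall>X. X \<subseteq> Y \<and> finite X \<and> card X = length xs \<longrightarrow>
    D (map ((!) (sorted_list_of_set X)) xs) = t" by blast
  \<comment> \<open>A set is coloured by the decision on its elements arranged in pattern
    \<open>q\<close>. Thinning \<open>Y\<close> further preserves constancy for the patterns in
    \<open>Q\<close>.\<close>
  obtain Y' t where "Y' \<subseteq> Y" "infinite Y'" "\<forall>X. X \<subseteq> Y' \<and> finite X \<and> card X = length q \<longrightarrow>
    D (map ((!) (sorted_list_of_set X)) q) = t"
    using Ramsey[OF Y(1), of "length q" "\<lambda>X. D (map ((!) (sorted_list_of_set X)) q)" s] D by blast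
  with Y show ?case by (intro exI[of _ Y']) (simp, meson subset_trans)
qed (rule exI[of _ UNIV], simp)

lemma sorted_list_of_set_strict_mono_image:
  fixes g :: "nat \<Rightarrow> nat"
  assumes "strict_mono g" "finite S"
  shows "sorted_list_of_set (g ` S) = map g (sorted_list_of_set S)"
proof (rule strict_sorted_equal)
  show "sorted_wrt (<) (map g (sorted_list_of_set S))"
    using assms strict_sorted_list_of_set[of S]
    by (auto simp: sorted_wrt_map strict_mono_less)
qed (use assms in auto)

text \<open>With \<open>e\<close> enumerating the Ramsey set, both \<open>e\<close> and its
  composition with \<open>f\<close> are increasing maps into that set, and \<open>D\<close> sees
  only the relative order of \<open>xs\<close>.\<close>

lemma Ramsey_order_invariant:
  fixes D :: "nat list \<Rightarrow> nat"
  assumes D: "\<And>ys. D ys < s"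
  obtains e :: "nat \<Rightarrow> nat" where "strict_mono e"
    "\<And>f xs. \<lbrakk>strict_mono f; distinct xs; length xs \<le> N\<rbrakk> \<Longrightarrow> D (map e (map f xs)) = D (map e xs)"
proof -
  define Q where "Q = {xs. set xs \<subseteq> {..<N} \<and> length xs \<le> N}"
  have "finite Q" unfolding Q_def by (intro finite_lists_length_le) auto
  from Ramsey_patterns[where D = D and s = s, OF this D]
  obtain Y where Y: "infinite Y \<and> (\<forall>q\<in>Q. \<exists>t. \<forall>X. X \<subseteq> Y \<and> finite X \<and> card X = length q \<longrightarrow>
    D (map ((!) (sorted_list_of_set X)) q) = t)"
    by (rule exE)
  have e: "strict_mono (enumerate Y)" "range (enumerate Y) = Y"
    using Y strict_mono_enumerate range_enumerate by blast+
  show ?thesis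
  proof (rule that[OF e(1)])
    fix f :: "nat \<Rightarrow> nat" and xs :: "nat list"
    assume f: "strict_mono f" and xs: "distinct xs" "length xs \<le> N"
    define sl where "sl = sorted_list_of_set (set xs)"
    have len: "length sl = length xs"
      using xs by (simp add: sl_def distinct_card)
    have "\<forall>x\<in>set xs. \<exists>i<length sl. sl ! i = x"
      unfolding sl_def by (metis List.finite_set in_set_conv_nth set_sorted_list_of_set)
    then obtain idx where idx: "\<And>x. x \<in> set xs \<Longrightarrow> idx x < length sl \<and> sl ! idx x = x"
      by metis
    \<comment> \<open>The relative order of \<open>xs\<close>: each entry is replaced by its
      position in the sorted list of entries.\<close>
    define q where "q = map idx xs"
    have q: "q \<in> Q" using idx len xs less_le_trans by (fastforce simp: Q_def q_def)
    obtain t where t: "\<forall>X. X \<subseteq> Y \<and> finite X \<and> card X = length q \<longrightarrow>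
      D (map ((!) (sorted_list_of_set X)) q) = t"
      by (rule exE[OF bspec[OF conjunct2[OF Y] q]])
    have *: "D (map g xs) = t" if g: "strict_mono g" "range g \<subseteq> Y" for g
    proof -
      have inj: "inj_on g (set xs)"
        using strict_mono_imp_inj_on[OF g(1)] inj_on_subset by blast
      have "D (map ((!) (sorted_list_of_set (g ` set xs))) q) = t"
        using g(2) xs inj by (intro t[rule_format]) (auto simp: q_def card_image distinct_card)
      moreover have "map ((!) (sorted_list_of_set (g ` set xs))) q = map g xs"
        using idx by (auto simp: q_def sorted_list_of_set_strict_mono_image[OF g(1)] simp flip: sl_def)
      ultimately show ?thesis by simp
    qed
    have "D (map (enumerate Y \<circ> f) xs) = t"
      using e f by (intro *) (auto simp: strict_mono_def)
    moreover have "D (map (enumerate Y) xs) = t"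
      using e by (intro *) auto
    ultimately show "D (map (enumerate Y) (map f xs)) = D (map (enumerate Y) xs)"
      by simp
  qed
qed

section \<open>The knapsack instances\<close>

text \<open>Item \<open>j\<close> is represented by \<open>j - 1\<close> in the list.\<close>

definition arrivals :: "nat \<Rightarrow> (nat \<Rightarrow> nat) \<Rightarrow> nat list" where
  "arrivals n \<pi> = map (\<lambda>k. \<pi> (Suc k) - 1) [0..<n]"

lemma Suc_arrivals_nth:
  assumes "\<pi> permutes {1..n}" "k < n"
  shows "Suc (arrivals n \<pi> ! k) = \<pi> (Suc k)"
  using permutes_in_image[OF assms(1), of "Suc k"] assms(2) by (simp add: arrivals_def)

lemma arrivals_in_orderings:
  assumes "\<pi> permutes {1..n}"
  shows "arrivals n \<pi> \<in> orderings n"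
proof -
  have len: "length (arrivals n \<pi>) = n" by (simp add: arrivals_def)
  have "distinct (arrivals n \<pi>)"
    unfolding distinct_conv_nth len
    using Suc_arrivals_nth[OF assms] permutes_inj[OF assms] by (metis injD nat.inject)
  moreover have "set (arrivals n \<pi>) \<subseteq> {..<n}"
  proof
    fix x assume "x \<in> set (arrivals n \<pi>)"
    then obtain k where "k < n" "x = arrivals n \<pi> ! k" by (auto simp: in_set_conv_nth len)
    then have "Suc x \<in> {1..n}"
      using Suc_arrivals_nth[OF assms] permutes_in_image[OF assms, of "Suc k"] by simp
    then show "x \<in> {..<n}" by simp
  qed
  ultimately show ?thesis
    unfolding permutations_of_set_def using len
    by (simp add: card_subset_eq distinct_card)
qed

lemma bij_betw_arrivals:
  "bij_betw (arrivals n) {\<pi>. \<pi> permutes {1..n}} (orderings n)"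
proof -
  have "inj_on (arrivals n) {\<pi>. \<pi> permutes {1..n}}"
  proof (intro inj_onI ext)
    fix \<pi> \<rho> j
    assume *: "\<pi> \<in> {\<pi>. \<pi> permutes {1..n}}" "\<rho> \<in> {\<pi>. \<pi> permutes {1..n}}" "arrivals n \<pi> = arrivals n \<rho>"
    show "\<pi> j = \<rho> j"
    proof (cases "j \<in> {1..n}")
      case True
      then obtain k where "j = Suc k" "k < n" by (cases j) auto
      then show ?thesis using * Suc_arrivals_nth by (metis mem_Collect_eq)
    next
      case False
      then show ?thesis using * by (metis mem_Collect_eq permutes_not_in)
    qed
  qed
  moreover have "arrivals n ` {\<pi>. \<pi> permutes {1..n}} \<subseteq> orderings n"
    using arrivals_in_orderings by auto
  moreover have "card {\<pi>. \<pi> permutes {1..n}} = card (orderings n)"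
    using card_permutations[of "{1..n}" n] by simp
  ultimately show ?thesis
    by (metis bij_betw_imageI card_image card_subset_eq finite_lessThan finite_permutations_of_set)
qed

lemma observed_eq_arrivals:
  assumes "\<pi> permutes {1..n}" "k < n"
  shows "observed v s \<pi> (Suc k) = map (\<lambda>x. (v (Suc x), s (Suc x))) (take (Suc k) (arrivals n \<pi>))"
proof (rule nth_equalityI)
  show "length (observed v s \<pi> (Suc k)) = length (map (\<lambda>x. (v (Suc x), s (Suc x))) (take (Suc k) (arrivals n \<pi>)))"
    using assms(2) by (simp add: observed_def arrivals_def)
  fix i assume "i < length (observed v s \<pi> (Suc k))"
  then have "i < Suc k" by (simp add: observed_def del: upt_Suc)
  then show "observed v s \<pi> (Suc k) ! i = map (\<lambda>x. (v (Suc x), s (Suc x))) (take (Suc k) (arrivals n \<pi>)) ! i"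
    using assms Suc_arrivals_nth[OF assms(1), of i]
    by (simp add: observed_def nth_append arrivals_def del: upt_Suc)
qed

text \<open>Indexing by arrival round cancels \<open>inv\<close>. The weights \<open>w\<close> are
  arbitrary so that the lemma serves values as well as sizes.\<close>

lemma sum_packing:
  assumes "\<pi> permutes {1..n}"
  shows "(\<Sum>j=1..n. w j * packing A n C v s \<pi> j)
    = (\<Sum>k<n. w (Suc (arrivals n \<pi> ! k)) *
        A n C (map (\<lambda>x. (v (Suc x), s (Suc x))) (take (Suc k) (arrivals n \<pi>))))"
proof -
  have "(\<Sum>j=1..n. w j * packing A n C v s \<pi> j) = (\<Sum>j=1..n. w (\<pi> j) * packing A n C v s \<pi> (\<pi> j))"
    using sum.permute[OF assms, of "\<lambda>j. w j * packing A n C v s \<pi> j"] by (simp add: o_def)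
  also have "\<dots> = (\<Sum>k<n. w (\<pi> (Suc k)) * A n C (observed v s \<pi> (Suc k)))"
    by (simp add: packing_def permutes_inverses[OF assms] sum.atLeast1_atMost_eq)
  also have "\<dots> = (\<Sum>k<n. w (Suc (arrivals n \<pi> ! k)) *
        A n C (map (\<lambda>x. (v (Suc x), s (Suc x))) (take (Suc k) (arrivals n \<pi>))))"
    using Suc_arrivals_nth[OF assms] observed_eq_arrivals[OF assms] by (intro sum.cong) auto
  finally show ?thesis .
qed

lemma expected_value_eq:
  "expected_value A n C v s = (\<Sum>xs\<in>orderings n. \<Sum>k<n. v (Suc (xs ! k)) *
     A n C (map (\<lambda>x. (v (Suc x), s (Suc x))) (take (Suc k) xs))) / fact n"
proof -
  let ?P = "{\<pi>. \<pi> permutes {1..n}}"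
  have "finite ?P" by (intro finite_permutations) simp
  moreover have "?P \<noteq> {}" using permutes_id by blast
  ultimately have "expected_value A n C v s
      = (\<Sum>\<pi>\<in>?P. solution_value n v (packing A n C v s \<pi>)) / fact n"
    using card_permutations[of "{1..n}" n] by (simp add: expected_value_def integral_pmf_of_set)
  also have "(\<Sum>\<pi>\<in>?P. solution_value n v (packing A n C v s \<pi>))
    = (\<Sum>\<pi>\<in>?P. \<Sum>k<n. v (Suc (arrivals n \<pi> ! k)) *
        A n C (map (\<lambda>x. (v (Suc x), s (Suc x))) (take (Suc k) (arrivals n \<pi>))))"
    unfolding solution_value_def by (intro sum.cong sum_packing) simp_all
  also have "\<dots> = (\<Sum>xs\<in>orderings n. \<Sum>k<n. v (Suc (xs ! k)) *
     A n C (map (\<lambda>x. (v (Suc x), s (Suc x))) (take (Suc k) xs)))"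
    by (rule sum.reindex_bij_betw[OF bij_betw_arrivals])
  finally show ?thesis .
qed

lemma deterministic_algorithm_arrivals:
  assumes A: "deterministic_algorithm A" and inst: "knapsack_inst n C v s"
    and xs: "xs \<in> orderings n"
  defines "a \<equiv> \<lambda>k. A n C (map (\<lambda>x. (v (Suc x), s (Suc x))) (take (Suc k) xs))"
  shows "\<And>k. k < n \<Longrightarrow> 0 \<le> a k \<and> a k \<le> 1" "(\<Sum>k<n. s (Suc (xs ! k)) * a k) \<le> C"
proof -
  have "xs \<in> arrivals n ` {\<pi>. \<pi> permutes {1..n}}"
    using xs by (simp only: bij_betw_imp_surj_on[OF bij_betw_arrivals])
  then obtain \<pi> where \<pi>: "\<pi> permutes {1..n}" "xs = arrivals n \<pi>"
    by blast
  have feas: "feasible n C s (packing A n C v s \<pi>)"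
    using A inst \<pi>(1) unfolding deterministic_algorithm_def by blast
  show "0 \<le> a k \<and> a k \<le> 1" if "k < n" for k
  proof -
    have "a k = packing A n C v s \<pi> (\<pi> (Suc k))"
      unfolding a_def packing_def \<pi>(2)
      using permutes_inverses(2)[OF \<pi>(1)] observed_eq_arrivals[OF \<pi>(1) that] by simp
    moreover have "\<pi> (Suc k) \<in> {1..n}"
      using permutes_in_image[OF \<pi>(1), of "Suc k"] that by simp
    ultimately show ?thesis using feas by (simp add: feasible_def)
  qed
  show "(\<Sum>k<n. s (Suc (xs ! k)) * a k) \<le> C"
    using feas sum_packing[OF \<pi>(1), of s A C v s] unfolding feasible_def a_def \<pi>(2) by simp
qed

section \<open>Unit sizes with geometrically separated values\<close>

lemma optimal_unit_sizes:
  assumes "0 < n" and v: "\<And>j. j \<in> {1..n} \<Longrightarrow> 0 \<le> v j \<and> v j \<le> v n"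
  shows "optimal n 1 v (\<lambda>_. 1) (\<lambda>j. of_bool (j = n))"
    "solution_value n v (\<lambda>j. of_bool (j = n)) = v n"
proof -
  have n: "n \<in> {1..n}" using assms(1) by simp
  show val: "solution_value n v (\<lambda>j. of_bool (j = n)) = v n"
    using n by (simp add: solution_value_def of_bool_def if_distrib[of "(*) _"] cong: if_cong)
  have "solution_value n v y \<le> v n" if y: "feasible n 1 (\<lambda>_. 1) y" for y
  proof -
    have "solution_value n v y \<le> (\<Sum>j=1..n. v n * y j)"
      unfolding solution_value_def using y v by (intro sum_mono mult_right_mono) (auto simp: feasible_def)
    also have "\<dots> = v n * (\<Sum>j=1..n. y j)" by (simp add: sum_distrib_left)
    also have "\<dots> \<le> v n * 1"
      using y v[OF n] by (intro mult_left_mono) (auto simp: feasible_def)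
    finally show ?thesis by simp
  qed
  moreover have "feasible n 1 (\<lambda>_. 1) (\<lambda>j. of_bool (j = n))"
    using n by (simp add: feasible_def of_bool_def)
  ultimately show "optimal n 1 v (\<lambda>_. 1) (\<lambda>j. of_bool (j = n))"
    by (simp add: optimal_def val)
qed

text \<open>The error terms: \<open>2 / real n\<close> from the linear program,
  \<open>1 / real K\<close> from rounding the decision on item \<open>n\<close>,
  \<open>1 / M\<close> from all other items together.\<close>

lemma hard_instance:
  assumes A: "deterministic_algorithm A" and n: "2 \<le> n" and K: "0 < K" and M: "1 < (M::real)"
  obtains v where "knapsack_inst n 1 v (\<lambda>_. 1)" "\<And>j. j \<in> {1..n} \<Longrightarrow> v j \<le> v n"
    "expected_value A n 1 v (\<lambda>_. 1) \<le> (1 / exp 1 + 2 / real n + 1 / real K + 1 / M) * v n"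
proof -
  \<comment> \<open>The clamp bounds the number of colours on every list, including lists on which
    \<open>A\<close> is unconstrained; on actual instances it changes nothing.\<close>
  define D where "D ys = min K (nat \<lfloor>real K * A n 1 (map (\<lambda>k. (M ^ k, 1)) ys)\<rfloor>)" for ys
  have "D ys < Suc K" for ys by (simp add: D_def)
  then obtain e :: "nat \<Rightarrow> nat" where e: "strict_mono e"
    and inv: "\<And>f xs. \<lbrakk>strict_mono f; distinct xs; length xs \<le> n\<rbrakk> \<Longrightarrow> D (map e (map f xs)) = D (map e xs)"
    using Ramsey_order_invariant[of D "Suc K" n] by blast
  \<comment> \<open>Exponents come from the Ramsey set in increasing order, so item \<open>n\<close>
    is the best and every other one is worth less by a factor of at least \<open>M\<close>.\<close>
  define v where "v j = M ^ e (j - 1)" for j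
  define h where "h xs = real (D (map e xs)) / real K" for xs
  define a where "a xs k = A n 1 (map (\<lambda>x. (v (Suc x), 1)) (take (Suc k) xs))" for xs k
  have inst: "knapsack_inst n 1 v (\<lambda>_. 1)"
    using M by (simp add: knapsack_inst_def v_def)
  have v_less: "v (Suc i) \<le> v n / M" if "Suc i < n" for i
  proof -
    have "Suc (e i) \<le> e (n - 1)" using that e by (simp add: strict_mono_less Suc_le_eq)
    then have "M ^ Suc (e i) \<le> M ^ e (n - 1)" using M by (intro power_increasing) auto
    then show ?thesis using M by (simp add: v_def field_simps)
  qed
  have vn: "0 < v n" using M by (simp add: v_def)
  have v_le: "v j \<le> v n" if "j \<in> {1..n}" for j
  proof -
    have "j - 1 \<le> n - 1" using that by (intro diff_le_mono) simp
    then have "e (j - 1) \<le> e (n - 1)" using e by (simp only: strict_mono_less_eq)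
    then show ?thesis using M by (simp add: v_def power_increasing)
  qed
  have a01: "0 \<le> a xs k \<and> a xs k \<le> 1" if "xs \<in> orderings n" "k < n" for xs k
    using deterministic_algorithm_arrivals(1)[OF A inst that] by (simp add: a_def)
  have a_sum: "(\<Sum>k<n. a xs k) \<le> 1" if "xs \<in> orderings n" for xs
    using deterministic_algorithm_arrivals(2)[OF A inst that] by (simp add: a_def)
  \<comment> \<open>Rounding down, rather than to the nearest level, keeps \<open>h\<close> below
    \<open>a\<close>, so the rounded rule inherits the capacity bound.\<close>
  have h_a: "h (take (Suc k) xs) \<le> a xs k \<and> a xs k \<le> h (take (Suc k) xs) + 1 / real K"
    if "xs \<in> orderings n" "k < n" for xs k
  proof -
    have "D (map e (take (Suc k) xs)) = min K (nat \<lfloor>real K * a xs k\<rfloor>)"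
      by (simp add: D_def a_def v_def o_def)
    moreover have b: "0 \<le> real K * a xs k" "real K * a xs k \<le> real K"
      using a01[OF that] by (auto simp: mult_left_le)
    ultimately have "real (D (map e (take (Suc k) xs))) = of_int \<lfloor>real K * a xs k\<rfloor>"
      by (simp add: min_def) linarith
    then have "real (D (map e (take (Suc k) xs))) \<le> real K * a xs k"
      "real K * a xs k \<le> real (D (map e (take (Suc k) xs))) + 1"
      by linarith+
    then show ?thesis using K by (simp add: h_def field_simps)
  qed
  interpret ordinal_rule n h
  proof
    fix xs assume xs: "xs \<in> orderings n"
    have "(\<Sum>k<n. h (take (Suc k) xs)) \<le> (\<Sum>k<n. a xs k)"
      using h_a[OF xs] by (intro sum_mono) auto
    then show "(\<Sum>k<n. h (take (Suc k) xs)) \<le> 1" using a_sum[OF xs] by linarith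
  qed (simp_all add: h_def inv[unfolded map_map])
  have val: "(\<Sum>k<n. v (Suc (xs ! k)) * a xs k)
      \<le> v n * ((\<Sum>k<n. h (take (Suc k) xs) * of_bool (xs ! k = n - 1)) + 1 / real K + 1 / M)"
    if xs: "xs \<in> orderings n" for xs
  proof -
    have len: "length xs = n" using length_orderings[OF xs] .
    have set: "set xs = {..<n}" "distinct xs" using xs by (auto simp: permutations_of_set_def)
    obtain k0 where k0: "k0 < n" "xs ! k0 = n - 1"
      using n set(1) len by (metis diff_less in_set_conv_nth lessThan_iff pos2 less_le_trans zero_less_one)
    have best: "of_bool (xs ! k = n - 1) = (of_bool (k = k0) :: real)" if "k < n" for k
      using nth_eq_iff_index_eq[OF set(2), of k k0] that k0 len by simp
    \<comment> \<open>The rounding error is charged only in the round \<open>k0\<close> of the best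
      item; the terms \<open>a xs k / M\<close> sum to at most \<open>1 / M\<close> because the
      packed fractions sum to at most 1.\<close>
    have "v (Suc (xs ! k)) * a xs k
      \<le> v n * (h (take (Suc k) xs) * of_bool (xs ! k = n - 1) + of_bool (k = k0) / real K + a xs k / M)"
      if k: "k < n" for k
    proof (cases "k = k0")
      case True
      have "a xs k \<le> h (take (Suc k) xs) + 1 / real K + a xs k / M"
        using h_a[OF xs k] a01[OF xs k] M by (simp add: add_increasing2)
      then show ?thesis using True k0 n vn by (simp add: mult_left_mono)
    next
      case False
      then have "xs ! k \<noteq> n - 1" using best[OF k] by auto
      moreover have "xs ! k < n" using set(1) len k nth_mem by blast
      ultimately have "v (Suc (xs ! k)) \<le> v n / M" by (intro v_less) simp
      then have "v (Suc (xs ! k)) * a xs k \<le> v n / M * a xs k"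
        using a01[OF xs k] by (intro mult_right_mono) auto
      then show ?thesis using False best[OF k] by simp
    qed
    then have "(\<Sum>k<n. v (Suc (xs ! k)) * a xs k)
      \<le> (\<Sum>k<n. v n * (h (take (Suc k) xs) * of_bool (xs ! k = n - 1) + of_bool (k = k0) / real K + a xs k / M))"
      by (intro sum_mono) auto
    also have "\<dots> = v n * ((\<Sum>k<n. h (take (Suc k) xs) * of_bool (xs ! k = n - 1))
      + (\<Sum>k<n. of_bool (k = k0)) / real K + (\<Sum>k<n. a xs k) / M)"
      by (simp only: sum.distrib sum_divide_distrib sum_distrib_left[symmetric])
    also have "(\<Sum>k<n. of_bool (k = k0)) = (1::real)"
      using k0 by (simp add: of_bool_def)
    also have "v n * ((\<Sum>k<n. h (take (Suc k) xs) * of_bool (xs ! k = n - 1)) + 1 / real K + (\<Sum>k<n. a xs k) / M)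
      \<le> v n * ((\<Sum>k<n. h (take (Suc k) xs) * of_bool (xs ! k = n - 1)) + 1 / real K + 1 / M)"
      using vn M a_sum[OF xs] by (intro mult_left_mono add_left_mono divide_right_mono) auto
    finally show ?thesis .
  qed
  have "expected_value A n 1 v (\<lambda>_. 1) = (\<Sum>xs\<in>orderings n. \<Sum>k<n. v (Suc (xs ! k)) * a xs k) / fact n"
    by (simp add: expected_value_eq a_def)
  also have "\<dots> \<le> (\<Sum>xs\<in>orderings n. v n * ((\<Sum>k<n. h (take (Suc k) xs) * of_bool (xs ! k = n - 1))
      + (1 / real K + 1 / M))) / fact n"
    using val by (intro divide_right_mono sum_mono) (auto simp: add.assoc)
  also have "\<dots> = v n * ((\<Sum>xs\<in>orderings n. \<Sum>k<n. h (take (Suc k) xs) * of_bool (xs ! k = n - 1)) / fact n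
      + (1 / real K + 1 / M))"
    unfolding sum_distrib_left[symmetric] sum.distrib
    using K M by (simp add: field_simps)
  also have "\<dots> \<le> v n * ((1 / exp 1 + 2 / real n) + (1 / real K + 1 / M))"
    using vn expected_best_le[OF n] by (intro mult_left_mono add_right_mono) auto
  finally have "expected_value A n 1 v (\<lambda>_. 1) \<le> (1 / exp 1 + 2 / real n + 1 / real K + 1 / M) * v n"
    by (simp add: algebra_simps)
  then show ?thesis using that[OF inst v_le] by blast
qed

theorem theorem4p3:
  fixes \<epsilon> :: real
  assumes "\<epsilon> > 0"
  shows "\<not> (\<exists>A. deterministic_algorithm A \<and> competitive (1 / exp 1 + \<epsilon>) A)"
proof
  assume "\<exists>A. deterministic_algorithm A \<and> competitive (1 / exp 1 + \<epsilon>) A"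
  then obtain A \<delta> where A: "deterministic_algorithm A" and \<delta>: "\<delta> \<in> o(\<lambda>_. 1 :: real)"
    and comp: "\<And>n C v s xopt. \<lbrakk>knapsack_inst n C v s; optimal n C v s xopt\<rbrakk> \<Longrightarrow>
      expected_value A n C v s \<ge> (1 / exp 1 + \<epsilon> - \<delta> n) * solution_value n v xopt"
    unfolding competitive_def by blast
  have "\<forall>\<^sub>F n in sequentially. \<bar>\<delta> n\<bar> \<le> \<epsilon> / 8"
    using landau_o.smallD[OF \<delta>, of "\<epsilon> / 8"] assms by simp
  moreover have "\<forall>\<^sub>F n in sequentially. 2 \<le> n \<and> 8 / \<epsilon> \<le> real n"
    by (intro eventually_conj eventually_ge_at_top)
       (meson eventually_sequentiallyI nat_ceiling_le_eq)
  ultimately have "\<forall>\<^sub>F n in sequentially. \<bar>\<delta> n\<bar> \<le> \<epsilon> / 8 \<and> 2 \<le> n \<and> 8 / \<epsilon> \<le> real n"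
    by (rule eventually_conj)
  then obtain n where n: "\<bar>\<delta> n\<bar> \<le> \<epsilon> / 8" "2 \<le> n" "8 / \<epsilon> \<le> real n"
    using eventually_happens by force
  \<comment> \<open>The errors add up to at most \<open>\<epsilon>\<close> / 2 on the upper bound
    and \<open>\<epsilon>\<close> / 8 from \<open>\<delta>\<close>, which is less than
    \<open>\<epsilon>\<close>.\<close>
  have n': "2 / real n \<le> \<epsilon> / 4" "1 / real n \<le> \<epsilon> / 8"
    using n assms by (simp_all add: field_simps)
  \<comment> \<open>Taking \<open>K\<close> and \<open>M\<close> equal to \<open>n\<close> makes
    every error term vanish as \<open>n\<close> grows.\<close>
  obtain v where v: "knapsack_inst n 1 v (\<lambda>_. 1)" "\<And>j. j \<in> {1..n} \<Longrightarrow> v j \<le> v n"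
    "expected_value A n 1 v (\<lambda>_. 1) \<le> (1 / exp 1 + 2 / real n + 1 / real n + 1 / real n) * v n"
    using hard_instance[OF A n(2), of n "real n"] n(2) by auto
  have pos: "\<And>j. j \<in> {1..n} \<Longrightarrow> 0 < v j" using v(1) by (simp add: knapsack_inst_def)
  have opt: "optimal n 1 v (\<lambda>_. 1) (\<lambda>j. of_bool (j = n))"
    "solution_value n v (\<lambda>j. of_bool (j = n)) = v n"
    using optimal_unit_sizes[of n v] n(2) v(2) pos by (force simp: less_imp_le)+
  have "(1 / exp 1 + \<epsilon> - \<delta> n) * v n \<le> (1 / exp 1 + 2 / real n + 1 / real n + 1 / real n) * v n"
    using order_trans[OF comp[OF v(1) opt(1)] v(3)] unfolding opt(2) .
  then have "1 / exp 1 + \<epsilon> - \<delta> n \<le> 1 / exp 1 + 2 / real n + 1 / real n + 1 / real n"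
    using pos[of n] n(2) by simp
  then show False using n(1) n' assms by linarith
qed

end
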